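(* Let $\tau$ be a comtrace over a comtrace alphabet $\Theta=(\Sigma,\mathit{sim},\mathit{ser})$. Then the relation $\widehat{\mathit{ind}}$ on $\widehat{\mathbb{S}}$ is irreflexive and symmetric, and the set $indiv(\tau)$, viewed as a set of words over the alphabet $\widehat{\mathbb{S}}$, is a (Mazurkiewicz) trace over the concurrent alphabet $(\widehat{\mathbb{S}},\widehat{\mathit{ind}})$, i.e. it is exactly one equivalence class of the trace equivalence generated by commuting adjacent $\widehat{\mathit{ind}}$-independent letters.
   Context: A comtrace alphabet is $\Theta=(\Sigma,\mathit{sim},\mathit{ser})$ with $\Sigma$ finite nonempty, $\mathit{ser}\subseteq\mathit{sim}\subseteq\Sigma\times\Sigma$, $\mathit{sim}$ irreflexive and symmetric. Steps: nonempty $A\subseteq\Sigma$ with $(a,b)\in\mathit{sim}$ for distinct $a,b\in A$. $\equiv_\Theta$ is the reflexive, symmetric, transitive closure of $uABz\sim_\Theta u(A\cup B)z$ for steps $A,B$ with $A\times B\subseteq\mathit{ser}$; comtraces are its classes. Let $\mathit{ind}=\mathit{ser}\cap\mathit{ser}^{-1}$ and $\mathit{sin}=\mathit{sim}\setminus\mathit{ser}$. For a step $A$, $a\equiv_A b$ iff $(a,b),(b,a)\in R^*$ with $R=\mathit{sin}\cap(A\times A)$; $A$ is indivisible if all its elements are $\equiv_A$-equivalent. $\widehat{\mathbb{S}}$ is the set of indivisible steps; $indiv(\tau)$ is the set of step sequences in $\tau$ consisting only of indivisible steps. Two indivisible steps $A,B$ are in $\widehat{\mathit{ind}}$ iff $A\times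 B\subseteq\mathit{ind}$; $\widehat{\mathit{dep}}$ is its complement. For a concurrent alphabet $(X,I)$ with $I$ irreflexive symmetric, trace equivalence on $X^*$ is the reflexive transitive closure of $uxyz\sim uyxz$ for $(x,y)\in I$, and traces are its classes. *)

theory Defs
  imports Main
begin

locale comtrace_alphabet =
  fixes \<Sigma> :: "'a set" and sim ser :: "'a rel"
  assumes finite_alphabet: "finite \<Sigma>"
    and nonempty_alphabet: "\<Sigma> \<noteq> {}"
    and ser_sub: "ser \<subseteq> sim"
    and sim_sub: "sim \<subseteq> \<Sigma> \<times> \<Sigma>"
    and irrefl_sim: "irrefl sim"
    and sym_sim: "sym sim"

definition steps :: "'a set \<Rightarrow> 'a rel \<Rightarrow> 'a set set" where
  "steps \<Sigma> sim = {A. A \<noteq> {} \<and> A \<subseteq> \<Sigma> \<and> pairwise (\<lambda>a b. (a, b) \<in> sim) A}"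

text \<open>
  For a comtrace alphabet, \<open>A \<times> B \<subseteq> ser\<close> already forces \<open>A \<union> B\<close> to be a step
  and \<open>A \<inter> B\<close> to be empty, so neither is demanded below.
\<close>

definition comtrace_sim :: "'a set \<Rightarrow> 'a rel \<Rightarrow> 'a rel \<Rightarrow> 'a set list rel" where
  "comtrace_sim \<Sigma> sim ser =
     {(u @ [A, B] @ z, u @ [A \<union> B] @ z) | u A B z.
        u \<in> lists (steps \<Sigma> sim) \<and> z \<in> lists (steps \<Sigma> sim) \<and>
        A \<in> steps \<Sigma> sim \<and> B \<in> steps \<Sigma> sim \<and> A \<times> B \<subseteq> ser}"

text \<open>
  The reflexive transitive closure of HOL is reflexive on the whole type; restricting it to
  the words over the alphabet gives the equivalence relation on that set of words.
\<close>

definition comtrace_equiv :: "'a set \<Rightarrow> 'a rel \<Rightarrow> 'a rel \<Rightarrow> 'a set list rel" where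
  "comtrace_equiv \<Sigma> sim ser =
     Restr ((comtrace_sim \<Sigma> sim ser \<union> (comtrace_sim \<Sigma> sim ser)\<inverse>)\<^sup>*) (lists (steps \<Sigma> sim))"

definition comtraces :: "'a set \<Rightarrow> 'a rel \<Rightarrow> 'a rel \<Rightarrow> 'a set list set set" where
  "comtraces \<Sigma> sim ser = lists (steps \<Sigma> sim) // comtrace_equiv \<Sigma> sim ser"

definition ind_rel :: "'a rel \<Rightarrow> 'a rel" where
  "ind_rel ser = ser \<inter> ser\<inverse>"

definition sin_rel :: "'a rel \<Rightarrow> 'a rel \<Rightarrow> 'a rel" where
  "sin_rel sim ser = sim - ser"

definition step_equiv :: "'a rel \<Rightarrow> 'a rel \<Rightarrow> 'a set \<Rightarrow> 'a \<Rightarrow> 'a \<Rightarrow> bool" where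
  "step_equiv sim ser A a b \<longleftrightarrow>
     (a, b) \<in> (sin_rel sim ser \<inter> A \<times> A)\<^sup>* \<and> (b, a) \<in> (sin_rel sim ser \<inter> A \<times> A)\<^sup>*"

definition indiv_steps :: "'a set \<Rightarrow> 'a rel \<Rightarrow> 'a rel \<Rightarrow> 'a set set" where
  "indiv_steps \<Sigma> sim ser =
     {A \<in> steps \<Sigma> sim. \<forall>a\<in>A. \<forall>b\<in>A. step_equiv sim ser A a b}"

definition indiv :: "'a set \<Rightarrow> 'a rel \<Rightarrow> 'a rel \<Rightarrow> 'a set list set \<Rightarrow> 'a set list set" where
  "indiv \<Sigma> sim ser \<tau> = {w \<in> \<tau>. set w \<subseteq> indiv_steps \<Sigma> sim ser}"

definition ind_hat :: "'a set \<Rightarrow> 'a rel \<Rightarrow> 'a rel \<Rightarrow> 'a set rel" where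
  "ind_hat \<Sigma> sim ser =
     {(A, B). A \<in> indiv_steps \<Sigma> sim ser \<and> B \<in> indiv_steps \<Sigma> sim ser \<and> A \<times> B \<subseteq> ind_rel ser}"

definition trace_swap :: "'x set \<Rightarrow> 'x rel \<Rightarrow> 'x list rel" where
  "trace_swap X I =
     {(u @ [x, y] @ z, u @ [y, x] @ z) | u x y z.
        u \<in> lists X \<and> z \<in> lists X \<and> x \<in> X \<and> y \<in> X \<and> (x, y) \<in> I}"

definition trace_equiv :: "'x set \<Rightarrow> 'x rel \<Rightarrow> 'x list rel" where
  "trace_equiv X I = Restr ((trace_swap X I)\<^sup>*) (lists X)"

definition traces :: "'x set \<Rightarrow> 'x rel \<Rightarrow> 'x list set set" where
  "traces X I = lists X // trace_equiv X I"

end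

theory Submission
  imports Defs
begin

text \<open>
  A step without a splitting \<open>B \<union> C\<close> with \<open>B \<times> C \<subseteq> ser\<close> is exactly an indivisible one, so every
  step \<open>A\<close> can be cut into a sequence of indivisible blocks in which earlier blocks are
  serialisable with later ones. A block cannot meet two blocks of another such sequence, since
  \<open>sin\<close> has no path crossing back over a cut; hence the blocks of \<open>A\<close> are determined by \<open>A\<close>, and
  two block sequences differ only by commuting independent blocks. Cutting all the steps of a
  step sequence thus gives a well-defined trace, and the generating relation \<open>AB \<sim> A \<union> B\<close> does
  not change it because the concatenation of block sequences of \<open>A\<close> and \<open>B\<close> is one of \<open>A \<union> B\<close>.
\<close>

section \<open>Reachability, and commutation inside words over any alphabet\<close>

lemma rtrancl_closed_set:
  assumes "(a, b) \<in> r\<^sup>*" and "a \<in> S" and "\<And>x y. (x, y) \<in> r \<Longrightarrow> x \<in> S \<Longrightarrow> y \<in> S"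
  shows "b \<in> S"
  using assms by (induction rule: rtrancl_induct) auto

lemma rtrancl_map_mono:
  assumes "(x, y) \<in> r\<^sup>*" and "\<And>x y. (x, y) \<in> r \<Longrightarrow> (f x, f y) \<in> s\<^sup>*"
  shows "(f x, f y) \<in> s\<^sup>*"
  using assms by (induction rule: rtrancl_induct) (auto intro: rtrancl_trans)

lemma trace_swap_context:
  assumes "(w, w') \<in> trace_swap X I" and "u \<in> lists X" and "z \<in> lists X"
  shows "(u @ w @ z, u @ w' @ z) \<in> trace_swap X I"
proof -
  from assms(1) obtain p x y q where "w = p @ [x, y] @ q" "w' = p @ [y, x] @ q"
    "p \<in> lists X" "q \<in> lists X" "x \<in> X" "y \<in> X" "(x, y) \<in> I"
    unfolding trace_swap_def by blast
  moreover from this assms have "u @ p \<in> lists X" "q @ z \<in> lists X" by auto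
  ultimately show ?thesis
    unfolding trace_swap_def
    by (intro CollectI exI[of _ "u @ p"] exI[of _ x] exI[of _ y] exI[of _ "q @ z"]) auto
qed

lemma trace_swaps_context:
  assumes "(w, w') \<in> (trace_swap X I)\<^sup>*" and "u \<in> lists X" and "z \<in> lists X"
  shows "(u @ w @ z, u @ w' @ z) \<in> (trace_swap X I)\<^sup>*"
  using assms(1)
  by (rule rtrancl_map_mono[where f = "\<lambda>w. u @ w @ z"])
    (auto dest: trace_swap_context[OF _ assms(2,3)])

text \<open>The path runs through \<open>u' @ v\<close>: first \<open>v\<close> is the context, then
  \<open>u'\<close>. Hence the membership hypotheses concern just these two factors.\<close>

lemma trace_swaps_append:
  assumes "(u, u') \<in> (trace_swap X I)\<^sup>*" and "(v, v') \<in> (trace_swap X I)\<^sup>*"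
    and "u' \<in> lists X" and "v \<in> lists X"
  shows "(u @ v, u' @ v') \<in> (trace_swap X I)\<^sup>*"
  using trace_swaps_context[OF assms(1), of "[]" v] trace_swaps_context[OF assms(2), of u' "[]"]
    assms(3,4) by (auto intro: rtrancl_trans)

lemma trace_swaps_move_to_front:
  assumes "p \<in> lists X" and "q \<in> lists X" and "x \<in> X" and "\<And>y. y \<in> set p \<Longrightarrow> (y, x) \<in> I"
  shows "(p @ x # q, x # p @ q) \<in> (trace_swap X I)\<^sup>*"
  using assms(1,4)
proof (induction p)
  case Nil
  then show ?case by simp
next
  case (Cons y p)
  then have "y \<in> X" "(y, x) \<in> I" "p @ q \<in> lists X" using assms(2) by simp_all
  have "(y # p @ x # q, y # x # p @ q) \<in> (trace_swap X I)\<^sup>*"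
    using trace_swaps_context[of "p @ x # q" "x # p @ q" X I "[y]" "[]"] Cons by simp
  moreover have "(y # x # p @ q, x # y # p @ q) \<in> trace_swap X I"
  proof -
    have "([] @ [y, x] @ p @ q, [] @ [x, y] @ p @ q) \<in> trace_swap X I"
      unfolding trace_swap_def using \<open>y \<in> X\<close> \<open>(y, x) \<in> I\<close> \<open>p @ q \<in> lists X\<close> assms(3) by blast
    then show ?thesis by simp
  qed
  ultimately show ?case by auto
qed

context comtrace_alphabet
begin

section \<open>Steps and their cuts into indivisible blocks\<close>

abbreviation "\<S> \<equiv> steps \<Sigma> sim"
abbreviation "\<I> \<equiv> indiv_steps \<Sigma> sim ser"
abbreviation "step_moves \<equiv> (comtrace_sim \<Sigma> sim ser \<union> (comtrace_sim \<Sigma> sim ser)\<inverse>)\<^sup>*"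
abbreviation "block_swaps \<equiv> (trace_swap \<I> (ind_hat \<Sigma> sim ser))\<^sup>*"

lemma not_ser_refl: "(a, a) \<notin> ser"
  using ser_sub irrefl_sim by (auto simp: irrefl_def)

lemma indiv_steps_sub: "\<I> \<subseteq> \<S>"
  by (auto simp: indiv_steps_def)

lemma steps_Un: "A \<in> \<S> \<Longrightarrow> B \<in> \<S> \<Longrightarrow> A \<times> B \<subseteq> ser \<Longrightarrow> A \<union> B \<in> \<S>"
  using ser_sub sym_sim unfolding steps_def pairwise_def sym_def
  by (simp add: subset_iff) blast

lemma steps_subset: "A \<in> \<S> \<Longrightarrow> B \<subseteq> A \<Longrightarrow> B \<noteq> {} \<Longrightarrow> B \<in> \<S>"
  unfolding steps_def pairwise_def by blast

lemma sym_ind_hat: "sym (ind_hat \<Sigma> sim ser)"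
  by (auto simp: sym_def ind_hat_def ind_rel_def)

text \<open>All ordered pairs of blocks are constrained, not only adjacent ones, since
  \<open>ser\<close> need not be transitive. As \<open>ser\<close> is irreflexive, blocks at
  different positions are disjoint.\<close>

definition cut :: "'a set \<Rightarrow> 'a set list \<Rightarrow> bool" where
  "cut A w \<longleftrightarrow> set w \<subseteq> \<I> \<and> \<Union>(set w) = A \<and> sorted_wrt (\<lambda>B C. B \<times> C \<subseteq> ser) w"

lemma cut_singleton: "A \<in> \<I> \<Longrightarrow> cut A [A]"
  by (simp add: cut_def)

lemma cut_append: "cut A v \<Longrightarrow> cut B w \<Longrightarrow> A \<times> B \<subseteq> ser \<Longrightarrow> cut (A \<union> B) (v @ w)"
  unfolding cut_def sorted_wrt_append by auto

text \<open>If some \<open>b\<close> cannot be reached from \<open>a\<close> along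
  \<open>sin\<close> inside \<open>A\<close>, let \<open>B\<close> be the set reached from
  \<open>a\<close>. A pair leaving \<open>B\<close> lies in \<open>sim\<close> but not in
  \<open>sin\<close>, hence in \<open>ser\<close>.\<close>

lemma splits_if_divisible:
  assumes "A \<in> \<S>" and "A \<notin> \<I>"
  obtains B C where "B \<union> C = A" "B \<noteq> {}" "C \<noteq> {}" "B \<times> C \<subseteq> ser" "C \<subset> A" "B \<subset> A"
proof -
  let ?R = "sin_rel sim ser \<inter> A \<times> A"
  obtain a b where ab: "a \<in> A" "b \<in> A" "(a, b) \<notin> ?R\<^sup>*"
    using assms unfolding indiv_steps_def step_equiv_def by blast
  define B where "B = {x \<in> A. (a, x) \<in> ?R\<^sup>*}"
  have "(x, y) \<in> ser" if "x \<in> B" "y \<in> A - B" for x y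
  proof -
    have "(x, y) \<notin> ?R"
      using that unfolding B_def by (blast intro: rtrancl_into_rtrancl)
    moreover have "x \<noteq> y" "x \<in> A" "y \<in> A" using that by (auto simp: B_def)
    moreover from this have "(x, y) \<in> sim"
      using assms(1) unfolding steps_def pairwise_def by blast
    ultimately show ?thesis by (auto simp: sin_rel_def)
  qed
  moreover have "a \<in> B" "b \<in> A - B" "B \<subseteq> A" using ab by (auto simp: B_def)
  ultimately show ?thesis using that[of B "A - B"] by blast
qed

lemma cut_exists:
  assumes "A \<in> \<S>"
  shows "\<exists>w. cut A w"
proof -
  have "finite A" using assms finite_alphabet by (auto simp: steps_def intro: finite_subset)
  then show ?thesis using assms
  proof (induction A rule: finite_psubset_induct)
    case (psubset A)
    show ?case
    proof (cases "A \<in> \<I>")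
      case True
      then show ?thesis using cut_singleton by blast
    next
      case False
      then obtain B C where "B \<union> C = A" "B \<noteq> {}" "C \<noteq> {}" "B \<times> C \<subseteq> ser" "C \<subset> A" "B \<subset> A"
        using splits_if_divisible psubset.prems by metis
      then show ?thesis
        using psubset.IH[of B] psubset.IH[of C] steps_subset[OF psubset.prems]
        by (metis cut_append psubset_imp_subset)
    qed
  qed
qed

text \<open>A \<open>sin\<close> path inside \<open>D\<close> never runs from an earlier block of
  \<open>w\<close> to a later one, as such pairs are in \<open>ser\<close>. The path from
  \<open>a\<close> to \<open>b\<close> shows that \<open>b\<close> is not after \<open>E\<close>,
  and the path back that \<open>b\<close> is not before \<open>E\<close>.\<close>

lemma indivisible_within_block:
  assumes "cut A w" and "D \<in> \<I>" and "D \<subseteq> A" and "E \<in> set w" and "a \<in> D" and "a \<in> E"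
  shows "D \<subseteq> E"
proof
  fix b assume b: "b \<in> D"
  obtain p q where w: "w = p @ E # q" using assms(4) by (meson split_list)
  let ?P = "\<Union>(set p)" and ?Q = "\<Union>(set q)" and ?R = "sin_rel sim ser \<inter> D \<times> D"
  have A: "A = ?P \<union> E \<union> ?Q"
    and "\<forall>B \<in> set p. \<forall>C \<in> set (E # q). B \<times> C \<subseteq> ser" "\<forall>C \<in> set q. E \<times> C \<subseteq> ser"
    using assms(1) unfolding cut_def w sorted_wrt_append by auto
  then have ser: "(?P \<union> E) \<times> ?Q \<subseteq> ser" "?P \<times> (E \<union> ?Q) \<subseteq> ser"
    by (simp_all, blast+)
  have ab: "(a, b) \<in> ?R\<^sup>*" and ba: "(b, a) \<in> ?R\<^sup>*"
    using assms(2,5) b by (auto simp: indiv_steps_def step_equiv_def)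
  have "b \<in> ?P \<union> E"
  proof (rule rtrancl_closed_set[OF ab])
    show "a \<in> ?P \<union> E" using assms(6) by simp
    show "y \<in> ?P \<union> E" if "(x, y) \<in> ?R" "x \<in> ?P \<union> E" for x y
    proof -
      have "y \<in> A" "(x, y) \<notin> ser" using that assms(3) by (auto simp: sin_rel_def)
      then show ?thesis using that(2) A ser(1) by blast
    qed
  qed
  moreover have "b \<notin> ?P"
  proof
    assume "b \<in> ?P"
    then have "a \<in> ?P"
    proof (rule rtrancl_closed_set[OF ba])
      show "y \<in> ?P" if "(x, y) \<in> ?R" "x \<in> ?P" for x y
      proof -
        have "y \<in> A" "(x, y) \<notin> ser" using that assms(3) by (auto simp: sin_rel_def)
        then show ?thesis using that(2) A ser(2) by blast
      qed
    qed
    then show False using ser(2) assms(6) not_ser_refl by blast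
  qed
  ultimately show "b \<in> E" by blast
qed

text \<open>The first block \<open>D\<close> of one cut also occurs in the other and can be moved to
  its front. What then remains are two cuts of the same set, to which the induction hypothesis
  applies.\<close>

lemma cut_unique: "cut A v \<Longrightarrow> cut A w \<Longrightarrow> (w, v) \<in> block_swaps"
proof (induction v arbitrary: A w)
  case Nil
  then have "\<Union>(set w) = {}" "set w \<subseteq> \<I>" by (auto simp: cut_def)
  then have "w = []" by (cases w) (auto simp: indiv_steps_def steps_def)
  then show ?case by simp
next
  case (Cons D v)
  have D: "D \<in> \<I>" "D \<subseteq> A" using Cons.prems(1) by (auto simp: cut_def)
  then obtain a where a: "a \<in> D" by (auto simp: indiv_steps_def steps_def)
  then obtain E where E: "E \<in> set w" "a \<in> E"
    using D Cons.prems(2) by (auto simp: cut_def)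
  then have "E \<in> \<I>" "E \<subseteq> A" using Cons.prems(2) by (auto simp: cut_def)
  \<comment> \<open>Two blocks sharing \<open>a\<close> contain each other: each is an indivisible
    step meeting a block of the other cut.\<close>
  then have "D = E"
    using indivisible_within_block[OF Cons.prems(2) D E(1) a E(2)]
      indivisible_within_block[OF Cons.prems(1) _ _ _ E(2) a] by auto
  then obtain p q where w: "w = p @ D # q" using E(1) by (meson split_list)
  let ?V = "\<Union>(set v)" and ?PQ = "\<Union>(set (p @ q))"
  have v: "cut ?V v" "D \<times> ?V \<subseteq> ser" "A = D \<union> ?V"
    using Cons.prems(1) by (auto simp: cut_def)
  have pq: "set (p @ q) \<subseteq> \<I>" "sorted_wrt (\<lambda>B C. B \<times> C \<subseteq> ser) (p @ q)" "A = D \<union> ?PQ"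
    and p: "\<And>P. P \<in> set p \<Longrightarrow> P \<times> D \<subseteq> ser" and q: "\<And>Q. Q \<in> set q \<Longrightarrow> D \<times> Q \<subseteq> ser"
    using Cons.prems(2) unfolding cut_def w sorted_wrt_append by auto
  \<comment> \<open>\<open>D\<close> is disjoint from all other blocks of both cuts, so removing it
    from \<open>A\<close> leaves the same set on either side.\<close>
  have "D \<inter> ?V = {}" using v(2) not_ser_refl by blast
  moreover have "D \<inter> P = {}" if "P \<in> set (p @ q)" for P
    using that p q not_ser_refl by fastforce
  ultimately have "?PQ = ?V" using v(3) pq(3) by blast
  then have "cut ?V (p @ q)" using pq by (simp add: cut_def)
  then have "(p @ q, v) \<in> block_swaps" using Cons.IH v(1) by blast
  then have "(D # p @ q, D # v) \<in> block_swaps"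
    using trace_swaps_context[of "p @ q" v _ _ "[D]" "[]"] D(1) by simp
  \<comment> \<open>\<open>P\<close> precedes \<open>D\<close> in \<open>w\<close>, but its elements
    lie in blocks after \<open>D\<close> in the other cut. So \<open>ser\<close> holds in both
    directions.\<close>
  moreover have "(P, D) \<in> ind_hat \<Sigma> sim ser" if "P \<in> set p" for P
  proof -
    have "P \<subseteq> ?V" using that unfolding \<open>?PQ = ?V\<close>[symmetric] by auto
    then have "D \<times> P \<subseteq> ser" using v(2) by blast
    then show ?thesis
      using p[OF that] pq(1) D(1) that by (auto simp: ind_hat_def ind_rel_def)
  qed
  then have "(p @ D # q, D # p @ q) \<in> block_swaps"
    using pq(1) D(1) by (intro trace_swaps_move_to_front) auto
  ultimately show ?case unfolding w by (rule rtrancl_trans[rotated])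
qed

section \<open>Cuts of step sequences and their invariance under step moves\<close>

definition cuts :: "'a set list \<Rightarrow> 'a set list list \<Rightarrow> bool" where
  "cuts s ws \<longleftrightarrow> list_all2 cut s ws"

lemma cuts_indiv: "cuts s ws \<Longrightarrow> concat ws \<in> lists \<I>"
  unfolding cuts_def by (induction rule: list_all2_induct) (auto simp: cut_def)

lemma cuts_exists: "s \<in> lists \<S> \<Longrightarrow> \<exists>ws. cuts s ws"
proof (induction s)
  case Nil
  then show ?case by (auto simp: cuts_def)
next
  case (Cons A s)
  then obtain w ws where "cut A w" "cuts s ws" using cut_exists[of A] by auto
  then have "cuts (A # s) (w # ws)" by (simp add: cuts_def)
  then show ?case ..
qed

lemma cuts_unique:
  "cuts s vs \<Longrightarrow> cuts s ws \<Longrightarrow> (concat vs, concat ws) \<in> block_swaps"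
proof (induction s arbitrary: vs ws)
  case Nil
  then show ?case by (simp add: cuts_def)
next
  case (Cons A s)
  then obtain v vs' w ws' where "vs = v # vs'" "ws = w # ws'" "cut A v" "cut A w"
    "cuts s vs'" "cuts s ws'"
    by (auto simp: cuts_def list_all2_Cons1)
  moreover from this have "w \<in> lists \<I>" "concat vs' \<in> lists \<I>"
    using cuts_indiv by (auto simp: cut_def)
  ultimately show ?case
    using Cons.IH cut_unique by (auto intro!: trace_swaps_append)
qed

lemma cuts_self: "w \<in> lists \<I> \<Longrightarrow> cuts w (map (\<lambda>A. [A]) w)"
  unfolding cuts_def by (induction w) (auto intro: cut_singleton)

text \<open>Only the grouping changes: the cuts of \<open>A\<close> and \<open>B\<close>, appended,
  form a single cut of \<open>A \<union> B\<close>.\<close>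

lemma cuts_comtrace_sim:
  assumes "(s, s') \<in> comtrace_sim \<Sigma> sim ser" and "cuts s ws"
  obtains ws' where "cuts s' ws'" "concat ws' = concat ws"
proof -
  obtain u A B z where s: "s = u @ [A, B] @ z" "s' = u @ [A \<union> B] @ z" and "A \<times> B \<subseteq> ser"
    using assms(1) unfolding comtrace_sim_def by blast
  moreover obtain us v w zs where "ws = us @ [v, w] @ zs" "cuts u us" "cut A v" "cut B w" "cuts z zs"
    using assms(2) unfolding cuts_def s by (auto simp: list_all2_append1 list_all2_Cons1)
  ultimately show ?thesis
    using that[of "us @ [v @ w] @ zs"]
    by (auto simp: cuts_def intro!: list_all2_appendI cut_append)
qed

lemma comtrace_sim_steps:
  assumes "(s, s') \<in> comtrace_sim \<Sigma> sim ser"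
  shows "s \<in> lists \<S>" "s' \<in> lists \<S>"
  using assms unfolding comtrace_sim_def by (auto intro: steps_Un)

lemma step_moves_cuts:
  assumes "(s, s') \<in> step_moves" and "cuts s ws" and "cuts s' ws'"
  shows "(concat ws, concat ws') \<in> block_swaps"
  using assms(1,3)
proof (induction arbitrary: ws' rule: rtrancl_induct)
  case base
  then show ?case using cuts_unique assms(2) by blast
next
  case (step t s')
  show ?case
  proof (cases "(t, s') \<in> comtrace_sim \<Sigma> sim ser")
    case True
    \<comment> \<open>Here \<open>s'\<close> arises from \<open>t\<close> by a join. The cut carried
      over from \<open>t\<close> may differ from \<open>ws'\<close>; \<open>cuts_unique\<close>
      closes this gap.\<close>
    then obtain vs where vs: "cuts t vs" using comtrace_sim_steps cuts_exists by blast
    then obtain vs' where "cuts s' vs'" "concat vs' = concat vs"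
      using cuts_comtrace_sim[OF True] by blast
    then show ?thesis using step.IH[OF vs] cuts_unique step.prems by (metis rtrancl_trans)
  next
    case False
    \<comment> \<open>Here \<open>t\<close> is the joined sequence, so \<open>ws'\<close> itself can
      be regrouped into a cut of \<open>t\<close>.\<close>
    then have "(s', t) \<in> comtrace_sim \<Sigma> sim ser" using step.hyps(2) by blast
    then obtain vs where "cuts t vs" "concat vs = concat ws'"
      using cuts_comtrace_sim step.prems by metis
    then show ?thesis using step.IH by metis
  qed
qed

section \<open>Realising cuts and block swaps by step moves\<close>

lemma step_moves_sym: "(s, s') \<in> step_moves \<Longrightarrow> (s', s) \<in> step_moves"
  by (meson symD sym_rtrancl sym_Un_converse)

lemma step_moves_context:
  assumes "(s, s') \<in> step_moves" and "u \<in> lists \<S>" and "z \<in> lists \<S>"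
  shows "(u @ s @ z, u @ s' @ z) \<in> step_moves"
proof -
  have sim: "(u @ s @ z, u @ s' @ z) \<in> comtrace_sim \<Sigma> sim ser"
    if "(s, s') \<in> comtrace_sim \<Sigma> sim ser" for s s'
  proof -
    from that obtain p A B q where "s = p @ [A, B] @ q" "s' = p @ [A \<union> B] @ q"
      "p \<in> lists \<S>" "q \<in> lists \<S>" "A \<in> \<S>" "B \<in> \<S>" "A \<times> B \<subseteq> ser"
      unfolding comtrace_sim_def by blast
    then show ?thesis
      unfolding comtrace_sim_def using assms(2,3)
      by (intro CollectI exI[of _ "u @ p"] exI[of _ A] exI[of _ B] exI[of _ "q @ z"]) auto
  qed
  show ?thesis
    by (rule rtrancl_map_mono[where f = "\<lambda>w. u @ w @ z", OF assms(1)]) (auto dest: sim)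
qed

lemma step_moves_join:
  assumes "u \<in> lists \<S>" "z \<in> lists \<S>" "A \<in> \<S>" "B \<in> \<S>" "A \<times> B \<subseteq> ser"
  shows "(u @ [A, B] @ z, u @ [A \<union> B] @ z) \<in> step_moves"
  using assms unfolding comtrace_sim_def by (intro r_into_rtrancl UnI1 CollectI) blast

text \<open>The blocks are split off from the left, one at a time. That the union is a step is
  proved alongside, because splitting \<open>D \<union> ?W\<close> requires \<open>?W\<close> to be
  a step.\<close>

lemma cut_step_moves: "cut A w \<Longrightarrow> w \<noteq> [] \<Longrightarrow> A \<in> \<S> \<and> ([A], w) \<in> step_moves"
proof (induction w arbitrary: A)
  case Nil
  then show ?case by simp
next
  case (Cons D w)
  have D: "D \<in> \<S>" using Cons.prems(1) indiv_steps_sub by (auto simp: cut_def)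
  show ?case
  proof (cases "w = []")
    case True
    then show ?thesis using Cons.prems(1) D by (simp add: cut_def)
  next
    case False
    let ?W = "\<Union>(set w)"
    have w: "cut ?W w" "D \<times> ?W \<subseteq> ser" "A = D \<union> ?W"
      using Cons.prems(1) by (auto simp: cut_def)
    then have W: "?W \<in> \<S>" "([?W], w) \<in> step_moves" using Cons.IH False by auto
    then have "([D, ?W], D # w) \<in> step_moves"
      using step_moves_context[of "[?W]" w "[D]" "[]"] D by simp
    moreover have "([D \<union> ?W], [D, ?W]) \<in> step_moves"
      using step_moves_join[of "[]" "[]" D ?W] D W(1) w(2) step_moves_sym by simp
    ultimately show ?thesis
      using steps_Un[OF D W(1) w(2)] unfolding w(3) by (meson rtrancl_trans)
  qed
qed

lemma cuts_step_moves: "s \<in> lists \<S> \<Longrightarrow> cuts s ws \<Longrightarrow> (s, concat ws) \<in> step_moves"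
proof (induction s arbitrary: ws)
  case Nil
  then show ?case by (simp add: cuts_def)
next
  case (Cons A s)
  then obtain w ws' where ws: "ws = w # ws'" "cut A w" "cuts s ws'"
    by (auto simp: cuts_def list_all2_Cons1)
  then have "w \<noteq> []" using Cons.prems(1) by (auto simp: cut_def steps_def)
  then have "(A # s, w @ s) \<in> step_moves"
    using cut_step_moves[OF ws(2)] step_moves_context[of "[A]" w "[]" s] Cons.prems(1) by auto
  moreover have "w \<in> lists \<S>" using ws(2) indiv_steps_sub by (auto simp: cut_def)
  then have "(w @ s, w @ concat ws') \<in> step_moves"
    using step_moves_context[of s "concat ws'" w "[]"] Cons ws(3) by auto
  ultimately show ?case unfolding ws(1) by (auto intro: rtrancl_trans)
qed

text \<open>For independent \<open>A\<close> and \<open>B\<close>, both orders join to the same step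
  \<open>A \<union> B\<close>, through which the swap passes.\<close>

lemma block_swaps_step_moves:
  assumes "(v, w) \<in> block_swaps"
  shows "(v, w) \<in> step_moves"
proof (rule rtrancl_map_mono[where f = "\<lambda>w. w", OF assms])
  fix v w assume "(v, w) \<in> trace_swap \<I> (ind_hat \<Sigma> sim ser)"
  then obtain u A B z where vw: "v = u @ [A, B] @ z" "w = u @ [B, A] @ z"
    and "u \<in> lists \<S>" "z \<in> lists \<S>" "A \<in> \<S>" "B \<in> \<S>" and "A \<times> B \<subseteq> ind_rel ser"
    unfolding trace_swap_def ind_hat_def using indiv_steps_sub lists_mono by blast
  moreover from this have "A \<times> B \<subseteq> ser" "B \<times> A \<subseteq> ser" by (auto simp: ind_rel_def)
  ultimately show "(v, w) \<in> step_moves"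
    using step_moves_join[of u z A B] step_moves_join[of u z B A] step_moves_sym
    unfolding vw Un_commute[of B A] by (meson rtrancl_trans)
qed

text \<open>Blocks are nonempty, so a block independent of itself would put some
  \<open>(a, a)\<close> into \<open>ser\<close>.\<close>

lemma irrefl_ind_hat: "irrefl_on \<I> (ind_hat \<Sigma> sim ser)"
  using not_ser_refl
  by (fastforce simp: irrefl_on_def ind_hat_def ind_rel_def indiv_steps_def steps_def)

lemma indiv_is_trace:
  assumes "\<tau> \<in> comtraces \<Sigma> sim ser"
  shows "indiv \<Sigma> sim ser \<tau> \<in> traces \<I> (ind_hat \<Sigma> sim ser)"
proof -
  obtain s where s: "s \<in> lists \<S>" and \<tau>: "\<tau> = comtrace_equiv \<Sigma> sim ser `` {s}"
    using assms unfolding comtraces_def by (rule quotientE)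
  obtain ws where ws: "cuts s ws" using cuts_exists[OF s] by blast
  let ?w = "concat ws"
  \<comment> \<open>The trace is the class of \<open>?w\<close>, obtained from any cut of any
    representative \<open>s\<close> of \<open>\<tau>\<close>.\<close>
  have "indiv \<Sigma> sim ser \<tau> = trace_equiv \<I> (ind_hat \<Sigma> sim ser) `` {?w}"
  proof (rule set_eqI)
    fix v
    have "(s, v) \<in> step_moves \<longleftrightarrow> (?w, v) \<in> block_swaps" if "v \<in> lists \<I>"
    proof
      assume "(s, v) \<in> step_moves"
      \<comment> \<open>A word of indivisible steps is its own cut, with singleton groups, so
        invariance compares it directly with \<open>?w\<close>.\<close>
      then show "(?w, v) \<in> block_swaps"
        using step_moves_cuts[OF _ ws cuts_self[OF that]] by simp
    next
      assume "(?w, v) \<in> block_swaps"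
      then show "(s, v) \<in> step_moves"
        using block_swaps_step_moves cuts_step_moves[OF s ws] by (meson rtrancl_trans)
    qed
    moreover have "v \<in> lists \<S>" if "v \<in> lists \<I>" using that indiv_steps_sub by auto
    ultimately show "v \<in> indiv \<Sigma> sim ser \<tau> \<longleftrightarrow> v \<in> trace_equiv \<I> (ind_hat \<Sigma> sim ser) `` {?w}"
      using s cuts_indiv[OF ws]
      unfolding indiv_def \<tau> comtrace_equiv_def trace_equiv_def in_lists_conv_set by blast
  qed
  then show ?thesis
    unfolding traces_def using cuts_indiv[OF ws] by (auto intro: quotientI)
qed

end

theorem theorem3p6:
  fixes \<Sigma> :: "'a set" and sim ser :: "'a rel" and \<tau> :: "'a set list set"
  assumes "comtrace_alphabet \<Sigma> sim ser"
    and "\<tau> \<in> comtraces \<Sigma> sim ser"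
  shows "irrefl_on (indiv_steps \<Sigma> sim ser) (ind_hat \<Sigma> sim ser) \<and>
         sym_on (indiv_steps \<Sigma> sim ser) (ind_hat \<Sigma> sim ser) \<and>
         indiv \<Sigma> sim ser \<tau> \<in> traces (indiv_steps \<Sigma> sim ser) (ind_hat \<Sigma> sim ser)"
  using comtrace_alphabet.irrefl_ind_hat[OF assms(1)]
    sym_on_subset[OF comtrace_alphabet.sym_ind_hat[OF assms(1)] subset_UNIV]
    comtrace_alphabet.indiv_is_trace[OF assms]
  by blast

end
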